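(* Let $0<u_z<1$, $0\le l_x\le u_z$, $0\le l_y\le u_z$, and let $\mathcal F'=\{(x,y,z)\in\mathbb R^3 : z=xy,\ l_x\le x\le 1,\ l_y\le y\le 1,\ 0\le z\le u_z\}$. Then $\operatorname{conv}(\mathcal F')$ is exactly the set of $(x,y,z)\in\mathbb R^3$ satisfying the RLT constraints $$z\ge x+y-1,\qquad z\ge l_yx+l_xy-l_xl_y,\qquad z\le x+l_xy-l_x,\qquad z\le l_yx+y-l_y,$$ the bound $z\le u_z$, and the second-order cone constraint $$u_z(z-l_xl_y)^2\le\big(u_z(x-l_x)+l_x(z-l_yx)\big)\big(u_z(y-l_y)+l_y(z-l_xy)\big).$$
   Context: $\operatorname{conv}$ denotes the convex hull in $\mathbb R^3$. "RLT" stands for Reformulation-Linearization Technique; the RLT constraints are written out in the claim for the box $l_x\le x\le 1$, $l_y\le y\le 1$. *)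

theory Defs
  imports "HOL-Analysis.Analysis"
begin

definition bilinear_set :: "real \<Rightarrow> real \<Rightarrow> real \<Rightarrow> (real \<times> real \<times> real) set" where
  "bilinear_set l\<^sub>x l\<^sub>y u\<^sub>z =
     {(x, y, z). z = x * y \<and> l\<^sub>x \<le> x \<and> x \<le> 1 \<and> l\<^sub>y \<le> y \<and> y \<le> 1 \<and> 0 \<le> z \<and> z \<le> u\<^sub>z}"

definition RLT :: "real \<Rightarrow> real \<Rightarrow> real \<Rightarrow> real \<Rightarrow> real \<Rightarrow> bool" where
  "RLT l\<^sub>x l\<^sub>y x y z \<longleftrightarrow>
     z \<ge> x + y - 1 \<and>
     z \<ge> l\<^sub>y * x + l\<^sub>x * y - l\<^sub>x * l\<^sub>y \<and>
     z \<le> x + l\<^sub>x * y - l\<^sub>x \<and>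
     z \<le> l\<^sub>y * x + y - l\<^sub>y"

text \<open>
  The linear forms on the right need no explicit sign conditions: for
  \<open>0 \<le> l\<^sub>x < 1\<close> and \<open>0 \<le> l\<^sub>y < 1\<close> the inequalities \<open>RLT\<close> force
  \<open>l\<^sub>x \<le> x\<close>, \<open>l\<^sub>y \<le> y\<close>, \<open>l\<^sub>y * x \<le> z\<close> and \<open>l\<^sub>x * y \<le> z\<close>, so both forms are
  nonnegative there and the inequality describes a rotated second-order cone.
\<close>

definition SOC :: "real \<Rightarrow> real \<Rightarrow> real \<Rightarrow> real \<Rightarrow> real \<Rightarrow> real \<Rightarrow> bool" where
  "SOC l\<^sub>x l\<^sub>y u\<^sub>z x y z \<longleftrightarrow>
     u\<^sub>z * (z - l\<^sub>x * l\<^sub>y)\<^sup>2 \<le>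
       (u\<^sub>z * (x - l\<^sub>x) + l\<^sub>x * (z - l\<^sub>y * x)) * (u\<^sub>z * (y - l\<^sub>y) + l\<^sub>y * (z - l\<^sub>x * y))"

end

theory Submission
  imports Defs
begin

text \<open>
  Seen from the apex \<open>P = (l\<^sub>x, l\<^sub>y, l\<^sub>x * l\<^sub>y)\<close>, all constraints except \<open>z \<le> u\<^sub>z\<close> and
  \<open>z \<ge> x + y - 1\<close> are homogeneous, and the conic constraint is the cone with apex \<open>P\<close> over the
  hyperbola \<open>x * y = u\<^sub>z\<close> in the plane \<open>z = u\<^sub>z\<close>. Hence the ray from \<open>P\<close> through a feasible point
  can be prolonged inside the relaxation until it meets one of these two planes. In the
  plane \<open>z = u\<^sub>z\<close> the exit point lies on a chord of slope \<open>-1\<close> of the hyperbola; in the plane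
  \<open>z = x + y - 1\<close> it lies on a segment joining the edges \<open>y = 1\<close> and \<open>x = 1\<close> of the surface
  \<open>z = x * y\<close>.
\<close>

section \<open>Inequalities for the rotated cone\<close>

lemma rotated_cone_add:
  fixes A B c A' B' c' u :: real
  assumes "0 \<le> u" "0 \<le> A" "0 \<le> B" "0 \<le> A'" "0 \<le> B'"
    and 1: "u * c\<^sup>2 \<le> A * B" and 2: "u * c'\<^sup>2 \<le> A' * B'"
  shows "u * (c + c')\<^sup>2 \<le> (A + A') * (B + B')"
proof -
  \<comment> \<open>Once the goal is expanded, only the cross terms remain to be compared; AM-GM for
    \<open>A * B'\<close> and \<open>A' * B\<close> settles them.\<close>
  have "(2 * (u * c * c'))\<^sup>2 = 4 * ((u * c\<^sup>2) * (u * c'\<^sup>2))"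
    by (simp add: power2_eq_square)
  also have "\<dots> \<le> 4 * ((A * B) * (A' * B'))"
    using assms by (intro mult_left_mono mult_mono[OF 1 2]) auto
  also have "\<dots> \<le> (A * B' + A' * B)\<^sup>2"
    using zero_le_power2[of "A * B' - A' * B"] by (simp add: power2_eq_square algebra_simps)
  finally have "2 * (u * c * c') \<le> A * B' + A' * B"
    by (rule power2_le_imp_le) (use assms in simp)
  with 1 2 show ?thesis
    by (simp add: power2_eq_square algebra_simps)
qed

lemma rotated_cone_scale:
  fixes A B c u t :: real
  assumes "u * c\<^sup>2 \<le> A * B"
  shows "u * (t * c)\<^sup>2 \<le> (t * A) * (t * B)"
  using mult_left_mono[OF assms, of "t\<^sup>2"] by (simp add: power2_eq_square mult_ac)

context
  fixes p q u :: real
  assumes u: "0 < u" "u < 1" and p: "0 \<le> p" "p \<le> u" and q: "0 \<le> q" "q \<le> u"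
begin

lemma apex_below: "p * q < u"
proof -
  have "p * q \<le> p * 1" using p q u by (intro mult_left_mono) auto
  moreover have "p * q < 1 * u" if "p = u" using that q u by simp
  ultimately show ?thesis using p by (cases "p = u") auto
qed

lemma RLT_imp_ge:
  assumes "RLT p q x y z"
  shows "p \<le> x" "q \<le> y" "q * x \<le> z" "p * y \<le> z"
proof -
  from assms have r: "z \<ge> q * x + p * y - p * q" "z \<le> x + p * y - p" "z \<le> q * x + y - q"
    by (auto simp: RLT_def)
  \<comment> \<open>Each product is the gap between an upper RLT bound on \<open>z\<close> and the
    lower bound \<open>q * x + p * y - p * q\<close>.\<close>
  have "0 \<le> (1 - q) * (x - p)" "0 \<le> (1 - p) * (y - q)"
    using r by (auto simp: algebra_simps)
  then show xy: "p \<le> x" "q \<le> y" using p q u by (auto simp: zero_le_mult_iff)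
  have "0 \<le> q * (x - p)" "0 \<le> p * (y - q)" using xy p q by auto
  then show "q * x \<le> z" "p * y \<le> z" using r by (auto simp: algebra_simps)
qed

section \<open>The relaxation: validity and convexity\<close>

definition relaxation :: "(real \<times> real \<times> real) set" where
  "relaxation = {(x, y, z). RLT p q x y z \<and> z \<le> u \<and> SOC p q u x y z}"

lemma bilinear_set_subset_relaxation: "bilinear_set p q u \<subseteq> relaxation"
proof safe
  fix x y z assume "(x, y, z) \<in> bilinear_set p q u"
  then have z: "z = x * y" and b: "p \<le> x" "x \<le> 1" "q \<le> y" "y \<le> 1" "x * y \<le> u"
    by (auto simp: bilinear_set_def)
  \<comment> \<open>With \<open>z = x * y\<close>, expanding each product of bound slacks yields one
    RLT inequality.\<close>
  have "0 \<le> (1 - x) * (1 - y)" "0 \<le> (x - p) * (y - q)" "0 \<le> (x - p) * (1 - y)"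
    "0 \<le> (1 - x) * (y - q)"
    using b by auto
  then have "RLT p q x y z" by (simp add: RLT_def z algebra_simps)
  moreover have "SOC p q u x y z"
  proof -
    \<comment> \<open>On the surface \<open>z = x * y\<close> the slack of the cone constraint
      factors completely into these nonnegative terms.\<close>
    have "0 \<le> (x - p) * (y - q) * ((u - x * y) * (u - p * q))"
      using b apex_below by auto
    also have "\<dots> = (u * (x - p) + p * (z - q * x)) * (u * (y - q) + q * (z - p * y))
        - u * (z - p * q)\<^sup>2"
      unfolding z by (simp add: power2_eq_square algebra_simps)
    finally show ?thesis by (simp add: SOC_def)
  qed
  ultimately show "(x, y, z) \<in> relaxation" using b z by (simp add: relaxation_def)
qed

lemma convex_relaxation: "convex relaxation"
proof (rule convexI, safe)
  fix x y z x' y' z' s t :: real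
  assume R: "(x, y, z) \<in> relaxation" "(x', y', z') \<in> relaxation"
    and st: "0 \<le> s" "0 \<le> t" "s + t = 1"
  have t: "t = 1 - s" using st by simp
  define X Y Z where XYZ: "X = s * x + t * x'" "Y = s * y + t * y'" "Z = s * z + t * z'"
  let ?A = "\<lambda>x z. u * (x - p) + p * (z - q * x)"
  let ?B = "\<lambda>y z. u * (y - q) + q * (z - p * y)"
  from R have r: "RLT p q x y z" "RLT p q x' y' z'" and zu: "z \<le> u" "z' \<le> u"
    and c: "u * (z - p * q)\<^sup>2 \<le> ?A x z * ?B y z" "u * (z' - p * q)\<^sup>2 \<le> ?A x' z' * ?B y' z'"
    by (auto simp: relaxation_def SOC_def)
  have comb: "s * f + t * f' \<le> s * g + t * g'" if "f \<le> g" "f' \<le> g'" for f f' g g' :: real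
    using that st by (intro add_mono mult_left_mono) auto
  have "RLT p q X Y Z"
    using r comb[of "x + y - 1" z "x' + y' - 1" z']
      comb[of "q * x + p * y - p * q" z "q * x' + p * y' - p * q" z']
      comb[of z "x + p * y - p" z' "x' + p * y' - p"]
      comb[of z "q * x + y - q" z' "q * x' + y' - q"]
    unfolding RLT_def XYZ t by (simp add: algebra_simps)
  moreover have "Z \<le> u"
    using comb[OF zu] unfolding XYZ t by (simp add: algebra_simps)
  moreover have "SOC p q u X Y Z"
  proof -
    \<comment> \<open>The quadratic inequality alone would also admit two negative forms; the RLT
      inequalities exclude that nappe.\<close>
    have pos: "0 \<le> ?A x z" "0 \<le> ?B y z" "0 \<le> ?A x' z'" "0 \<le> ?B y' z'"
      using RLT_imp_ge[OF r(1)] RLT_imp_ge[OF r(2)] u p q by auto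
    have "u * (s * (z - p * q) + t * (z' - p * q))\<^sup>2
        \<le> (s * ?A x z + t * ?A x' z') * (s * ?B y z + t * ?B y' z')"
      using u st pos c by (intro rotated_cone_add rotated_cone_scale mult_nonneg_nonneg) auto
    also have "s * (z - p * q) + t * (z' - p * q) = Z - p * q"
      unfolding XYZ t by (simp add: algebra_simps)
    also have "s * ?A x z + t * ?A x' z' = ?A X Z"
      unfolding XYZ t by (simp add: algebra_simps)
    also have "s * ?B y z + t * ?B y' z' = ?B Y Z"
      unfolding XYZ t by (simp add: algebra_simps)
    finally show ?thesis by (simp add: SOC_def)
  qed
  ultimately show "s *\<^sub>R (x, y, z) + t *\<^sub>R (x', y', z') \<in> relaxation"
    by (simp add: relaxation_def XYZ)
qed

section \<open>Hull points in the two exit planes\<close>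

lemma apex_in_bilinear_set: "(p, q, p * q) \<in> bilinear_set p q u"
  using u p q apex_below by (simp add: bilinear_set_def)

text \<open>Since \<open>r * s = u\<close>, the sum bound reads
  \<open>0 \<le> (1 - r) * (1 - s)\<close>, and \<open>u < 1\<close> then keeps both factors at most
  1. So each is at least \<open>u\<close>, hence at least \<open>p\<close> and
  \<open>q\<close>.\<close>

lemma hyperbola_in_bilinear_set:
  assumes "r + s \<le> 1 + u" "r * s = u" "0 < r" "r \<le> s"
  shows "(r, s, u) \<in> bilinear_set p q u" "(s, r, u) \<in> bilinear_set p q u"
proof -
  have "(1 - r) * (1 - s) \<ge> 0" using assms by (simp add: algebra_simps)
  moreover have "\<not> 1 < r"
  proof
    assume "1 < r"
    then have "1 * 1 < r * s" using assms by (intro mult_strict_mono) auto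
    with assms u show False by simp
  qed
  ultimately have "r \<le> 1 \<and> s \<le> 1"
    using assms u by (cases "r = 1") (auto simp: zero_le_mult_iff)
  moreover from this have "u \<le> r * 1" "u \<le> 1 * s"
    using assms by (metis mult_left_mono less_imp_le, metis mult_right_mono less_imp_le order_trans)
  ultimately show "(r, s, u) \<in> bilinear_set p q u" "(s, r, u) \<in> bilinear_set p q u"
    using assms p q u by (auto simp: bilinear_set_def mult.commute)
qed

lemma top_in_hull:
  assumes "0 \<le> x" "0 \<le> y" "u \<le> x * y" "x + y \<le> 1 + u"
  shows "(x, y, u) \<in> convex hull (bilinear_set p q u)"
proof -
  \<comment> \<open>The line of slope -1 through the point meets the hyperbola at
    \<open>(c - d, c + d)\<close> and \<open>(c + d, c - d)\<close>.\<close>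
  define c d where "c = (x + y) / 2" and "d = sqrt (c\<^sup>2 - u)"
  have c2: "c\<^sup>2 - x * y = ((x - y) / 2)\<^sup>2"
    by (simp add: c_def power2_eq_square field_simps)
  then have cu: "u \<le> c\<^sup>2" using assms zero_le_power2[of "(x - y) / 2"] by linarith
  then have d2: "d\<^sup>2 = c\<^sup>2 - u" and d0: "0 \<le> d" by (auto simp: d_def)
  have c0: "0 \<le> c" using assms by (simp add: c_def)
  have "d < c" by (rule power2_less_imp_less) (use d2 u c0 in auto)
  then have H: "(c - d, c + d, u) \<in> bilinear_set p q u" "(c + d, c - d, u) \<in> bilinear_set p q u"
    using d0 d2 assms
    by (intro hyperbola_in_bilinear_set; simp add: c_def power2_eq_square algebra_simps)+
  have "((x - y) / 2)\<^sup>2 \<le> d\<^sup>2" using d2 c2 assms by linarith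
  then have le: "\<bar>(x - y) / 2\<bar> \<le> d" using d0 by (simp add: abs_le_square_iff[symmetric])
  show ?thesis
  proof (cases "d = 0")
    case True
    with le H(1) have "(x, y, u) \<in> bilinear_set p q u" by (simp add: c_def)
    then show ?thesis by (rule hull_inc)
  next
    case False
    \<comment> \<open>The position of the point on the chord, solved from
      \<open>x = c + (2 * s - 1) * d\<close>; the bound \<open>le\<close> puts it in [0, 1].\<close>
    define s where "s = (1 + (x - y) / (2 * d)) / 2"
    have "0 \<le> s" "0 \<le> 1 - s"
      using le False d0 by (auto simp: s_def field_simps abs_le_iff)
    then have "s *\<^sub>R (c + d, c - d, u) + (1 - s) *\<^sub>R (c - d, c + d, u)
        \<in> convex hull (bilinear_set p q u)"
      using H by (intro convexD[OF convex_convex_hull] hull_inc) auto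
    also have "s *\<^sub>R (c + d, c - d, u) + (1 - s) *\<^sub>R (c - d, c + d, u) = (x, y, u)"
      using False by (simp add: s_def c_def field_simps)
    finally show ?thesis .
  qed
qed

lemma slanted_in_hull:
  assumes "x \<le> 1" "y \<le> 1" "x + y \<le> 1 + u"
    and low: "q * x + p * y - p * q \<le> x + y - 1"
  shows "(x, y, x + y - 1) \<in> convex hull (bilinear_set p q u)"
proof -
  \<comment> \<open>The segment from \<open>(1 - \<alpha> t, 1)\<close> to
    \<open>(1, 1 - \<beta> t)\<close> sweeps the plane: its free coordinates move from
    \<open>u\<close> at \<open>t = 0\<close> to \<open>p\<close> and \<open>q\<close> at
    \<open>t = 1\<close>.\<close>
  define \<alpha> \<beta> where "\<alpha> = (\<lambda>t. 1 - u + t * (u - p))" and "\<beta> = (\<lambda>t. 1 - u + t * (u - q))"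
  have pos: "0 < \<alpha> t" "0 < \<beta> t" if "0 \<le> t" for t
    using that u p q by (auto simp: \<alpha>_def \<beta>_def intro!: add_pos_nonneg)
  \<comment> \<open>\<open>f t = 1\<close> says that \<open>(x, y)\<close> is on the line through
    those endpoints. The sum bound gives \<open>f 0 \<ge> 1\<close>, and \<open>low\<close> is
    equivalent to \<open>f 1 \<le> 1\<close>, so some intermediate line passes through the
    point.\<close>
  define f where "f = (\<lambda>t. (1 - x) / \<alpha> t + (1 - y) / \<beta> t)"
  have f0: "1 \<le> f 0" using assms u by (simp add: f_def \<alpha>_def \<beta>_def flip: add_divide_distrib)
  have f1: "f 1 \<le> 1"
    using low u p q by (simp add: f_def \<alpha>_def \<beta>_def divide_simps) (simp add: algebra_simps)
  have "continuous_on {0..1} f"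
    unfolding f_def using pos
    by (intro continuous_intros) (auto simp: \<alpha>_def \<beta>_def less_le intro!: continuous_intros)
  then obtain t where t: "0 \<le> t" "t \<le> 1" "f t = 1"
    using IVT2'[of f 1 1 0] f0 f1 by auto
  define s where "s = (1 - x) / \<alpha> t"
  have s: "1 - s = (1 - y) / \<beta> t" using t by (simp add: f_def s_def)
  have "0 \<le> s" "0 \<le> 1 - s" using assms pos[OF t(1)] unfolding s by (auto simp: s_def)
  moreover have "(1 - \<alpha> t, 1, 1 - \<alpha> t) \<in> bilinear_set p q u"
    "(1, 1 - \<beta> t, 1 - \<beta> t) \<in> bilinear_set p q u"
  proof -
    have "t * (u - p) \<le> 1 * (u - p)" "t * (u - q) \<le> 1 * (u - q)"
      by (intro mult_right_mono; use t p q in simp)+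
    moreover have "0 \<le> t * (u - p)" "0 \<le> t * (u - q)" using t p q by auto
    ultimately show "(1 - \<alpha> t, 1, 1 - \<alpha> t) \<in> bilinear_set p q u"
      "(1, 1 - \<beta> t, 1 - \<beta> t) \<in> bilinear_set p q u"
      using u p q by (auto simp: bilinear_set_def \<alpha>_def \<beta>_def)
  qed
  ultimately have "s *\<^sub>R (1 - \<alpha> t, 1, 1 - \<alpha> t) + (1 - s) *\<^sub>R (1, 1 - \<beta> t, 1 - \<beta> t)
      \<in> convex hull (bilinear_set p q u)"
    by (intro convexD[OF convex_convex_hull] hull_inc) auto
  also have "s *\<^sub>R (1 - \<alpha> t, 1, 1 - \<alpha> t) + (1 - s) *\<^sub>R (1, 1 - \<beta> t, 1 - \<beta> t) = (x, y, x + y - 1)"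
  proof -
    have "s * \<alpha> t = 1 - x" "(1 - s) * \<beta> t = 1 - y"
      unfolding s using pos[OF t(1)] by (auto simp: s_def)
    then show ?thesis by (simp add: algebra_simps)
  qed
  finally show ?thesis .
qed

lemma exit_point_in_hull:
  assumes R: "(x, y, z) \<in> relaxation" and e: "z = u \<or> z = x + y - 1"
  shows "(x, y, z) \<in> convex hull (bilinear_set p q u)"
proof -
  from R have r: "RLT p q x y z" and zu: "z \<le> u" and S: "SOC p q u x y z"
    by (auto simp: relaxation_def)
  note ge = RLT_imp_ge[OF r]
  from e show ?thesis
  proof
    assume z: "z = u"
    \<comment> \<open>At \<open>z = u\<close> the two linear forms collapse to
      \<open>(u - p * q) * x\<close> and \<open>(u - p * q) * y\<close>.\<close>
    have "(u - p * q)\<^sup>2 * u \<le> (u - p * q)\<^sup>2 * (x * y)"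
      using S unfolding SOC_def z by (simp add: power2_eq_square algebra_simps)
    then have "u \<le> x * y" using apex_below by (subst (asm) mult_le_cancel_left_pos) auto
    with r ge p q show ?thesis unfolding z by (intro top_in_hull) (auto simp: RLT_def)
  next
    assume z: "z = x + y - 1"
    \<comment> \<open>These are the gaps between the upper RLT bounds and
      \<open>x + y - 1\<close>.\<close>
    have "0 \<le> (1 - p) * (1 - y)" "0 \<le> (1 - q) * (1 - x)"
      using r by (auto simp: RLT_def z algebra_simps)
    then have "x \<le> 1" "y \<le> 1" using u p q by (auto simp: zero_le_mult_iff)
    with r zu show ?thesis unfolding z by (intro slanted_in_hull) (auto simp: RLT_def z)
  qed
qed

section \<open>Prolonging rays from the apex\<close>

lemma relaxation_ray:
  fixes a b c t :: real
  assumes R: "(p + a, q + b, p * q + c) \<in> relaxation" and t: "0 \<le> t"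
    and "t * c \<le> u - p * q" "t * (a + b - c) \<le> (1 - p) * (1 - q)"
  shows "(p + t * a, q + t * b, p * q + t * c) \<in> relaxation"
proof -
  from R have r: "RLT p q (p + a) (q + b) (p * q + c)" and S: "SOC p q u (p + a) (q + b) (p * q + c)"
    by (auto simp: relaxation_def)
  from r have h: "q * a + p * b \<le> c" "c \<le> a + p * b" "c \<le> q * a + b"
    by (auto simp: RLT_def algebra_simps)
  \<comment> \<open>The inequalities \<open>h\<close> are homogeneous and scale by \<open>t\<close>;
    the remaining RLT bound is the premise on \<open>a + b - c\<close>.\<close>
  have "RLT p q (p + t * a) (q + t * b) (p * q + t * c)"
    using h[THEN mult_left_mono, OF t] assms(4) by (simp add: RLT_def algebra_simps)
  moreover have "SOC p q u (p + t * a) (q + t * b) (p * q + t * c)"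
  proof -
    have "u * c\<^sup>2 \<le> (u * a + p * (c - q * a)) * (u * b + q * (c - p * b))"
      using S by (simp add: SOC_def algebra_simps)
    from rotated_cone_scale[OF this, of t] show ?thesis
      by (simp add: SOC_def algebra_simps)
  qed
  ultimately show ?thesis using assms(3) by (simp add: relaxation_def)
qed

lemma relaxation_subset_hull: "relaxation \<subseteq> convex hull (bilinear_set p q u)"
proof safe
  fix x y z assume R: "(x, y, z) \<in> relaxation"
  define a b c where abc: "a = x - p" "b = y - q" "c = z - p * q"
  \<comment> \<open>The slacks of \<open>z \<le> u\<close> and \<open>z \<ge> x + y - 1\<close> at
    the apex.\<close>
  define k l where "k = u - p * q" and "l = (1 - p) * (1 - q)"
  have k: "0 < k" and l: "0 < l" using apex_below u p q by (auto simp: k_def l_def)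
  from R have r: "RLT p q x y z" and zu: "z \<le> u" by (auto simp: relaxation_def)
  have ab: "0 \<le> a" "0 \<le> b" using RLT_imp_ge[OF r] by (auto simp: abc)
  have "q * a + p * b \<le> c" using r by (auto simp: abc RLT_def algebra_simps)
  moreover have "0 \<le> q * a" "0 \<le> p * b" using ab p q by auto
  ultimately have c: "0 \<le> c" by linarith
  \<comment> \<open>The larger fraction of these slacks used up at the point, so that for
    \<open>m > 0\<close> the ray first meets one of the planes at parameter
    \<open>1 / m\<close>.\<close>
  define m where "m = max (c / k) ((a + b - c) / l)"
  have m0: "0 \<le> m" using c k by (simp add: m_def le_max_iff_disj)
  have "c / k \<le> 1" using zu k by (simp add: abc k_def)
  moreover have "(a + b - c) / l \<le> 1"
    using r l by (simp add: abc l_def RLT_def) (simp add: algebra_simps)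
  ultimately have m1: "m \<le> 1" by (simp add: m_def)
  have mk: "c \<le> m * k" and ml: "a + b - c \<le> m * l"
    using k l by (simp_all add: pos_divide_le_eq[symmetric] m_def)
  show "(x, y, z) \<in> convex hull (bilinear_set p q u)"
  proof (cases "m = 0")
    case True
    with mk ml c ab have "a = 0" "b = 0" "c = 0" by auto
    then have "(x, y, z) = (p, q, p * q)" by (simp add: abc)
    then show ?thesis using apex_in_bilinear_set by (simp add: hull_inc)
  next
    case False
    with m0 have m: "0 < m" by simp
    define Q where "Q = (p + 1 / m * a, q + 1 / m * b, p * q + 1 / m * c)"
    have "Q \<in> relaxation"
      unfolding Q_def using R m mk ml
      by (intro relaxation_ray) (simp_all add: abc k_def l_def field_simps)
    moreover have "p * q + 1 / m * c = u \<or>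
        p * q + 1 / m * c = (p + 1 / m * a) + (q + 1 / m * b) - 1"
    proof -
      have "c = m * k \<or> a + b - c = m * l" using k l by (auto simp: m_def max_def)
      then have "1 / m * c = k \<or> 1 / m * (a + b - c) = l" using m by auto
      then show ?thesis unfolding k_def l_def ring_distribs by auto
    qed
    ultimately have "Q \<in> convex hull (bilinear_set p q u)"
      unfolding Q_def by (rule exit_point_in_hull)
    \<comment> \<open>The point lies at fraction \<open>m\<close> of the way from the apex to
      \<open>Q\<close>.\<close>
    then have "m *\<^sub>R Q + (1 - m) *\<^sub>R (p, q, p * q) \<in> convex hull (bilinear_set p q u)"
      using m m1 apex_in_bilinear_set
      by (intro convexD[OF convex_convex_hull]) (auto intro: hull_inc)
    also have "m *\<^sub>R Q + (1 - m) *\<^sub>R (p, q, p * q) = (x, y, z)"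
      using m by (simp add: Q_def abc field_simps)
    finally show ?thesis .
  qed
qed

lemma hull_eq_relaxation: "convex hull (bilinear_set p q u) = relaxation"
  using relaxation_subset_hull hull_minimal[of _ _ convex, OF bilinear_set_subset_relaxation convex_relaxation]
  by blast

end

theorem proposition5:
  fixes l\<^sub>x l\<^sub>y u\<^sub>z :: real
  assumes "0 < u\<^sub>z" and "u\<^sub>z < 1"
    and "0 \<le> l\<^sub>x" and "l\<^sub>x \<le> u\<^sub>z"
    and "0 \<le> l\<^sub>y" and "l\<^sub>y \<le> u\<^sub>z"
  shows "convex hull (bilinear_set l\<^sub>x l\<^sub>y u\<^sub>z) =
    {(x, y, z). RLT l\<^sub>x l\<^sub>y x y z \<and> z \<le> u\<^sub>z \<and> SOC l\<^sub>x l\<^sub>y u\<^sub>z x y z}"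
  using hull_eq_relaxation[OF assms] relaxation_def[OF assms] by simp

end
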